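(* Let the setting, the iteration with a posteriori choice of $\alpha_k$, and all assumptions on $J$, $M$, $J^\delta$, $\tilde M^\delta$, $G^\delta$, $H^\delta$, $\mathcal R$, $\eta$, $x^\dagger$, $x^*$ listed in the context hold. In particular assume that there are constants $\underline a,\underline b,\overline a,\overline b\ge0$ such that for all $\delta\in(0,\bar\delta)$ and all $x,x_+\in\tilde M^\delta$ $$\underline aJ^\delta(x_+)-\underline bJ^\delta(x)\ \le\ G^\delta(x)(x_+-x)+\tfrac12H^\delta(x)(x_+-x)^2\ \le\ \overline aJ^\delta(x_+)-\overline bJ^\delta(x).$$ Let $k_*(\delta)=\min\{k : J^\delta(x_k)\le\tau\eta(\delta)\}$ with $\tau>1$, and assume that the constants $0<\underline\sigma<\overline\sigma<1$ and $\tau$ satisfy $$1+\frac{\overline a}{\tau}<\underline\sigma+\overline b,\qquad \overline\sigma+\underline b<1+\underline a .$$ Then: (1) For any $\delta\in(0,\bar\delta)$ and any $x_0\in\bigcap_{\delta\in(0,\bar\delta)}\tilde M^\delta\cap M$: (i) the iterates $x_k$ are well-defined for all $k\le k_*(\delta)$ (i.e. the required $\alpha_k$ and minimizers exist), and $k_*(\delta)$ is finite; (ii) for all $k\in\{1,\dots,k_*(\delta)\}$ and $q=\frac{\overline\sigma-1+\underline b}{\underline a}<1$, $\;J^\delta(x_k)\le q\,J^\delta(x_{k-1})$; (iii) for all $k\in\{1,\dots,k_*(\delta)\}$ and any $\hat x$ satisfying the condition imposed on $x^\dagger$, i.e. $\hat x\in\tilde M^{\delta'}$ and $J^{\delta'}(\hat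 x)\le\eta(\delta')$ for all $\delta'\in(0,\bar\delta)$, we have $\mathcal R(x_k)\le\mathcal R(\hat x)$, and $\hat x$ is a minimizer of $J$ over $M$. (2) As $\delta\to0$, the final iterates $x_{k_*(\delta)}$ tend to a solution of $\min\{J(x):x\in M\}$ $\mathcal T$-subsequentially, i.e. every sequence $x_{k_*(\delta_j)}$ with $\delta_j\to0$ as $j\to\infty$ has a $\mathcal T$-convergent subsequence, and the limit of every $\mathcal T$-convergent subsequence is a minimizer of $J$ over $M$.
   Context: $X$ is a real Banach space, $M\subseteq X$, and $J$ is a proper functional on $X$ with $J\ge0$ on $M$ and $J(x^\dagger)=\min_{x\in M}J(x)=0$ for a given $x^\dagger\in M$. For each $\delta\in(0,\bar\delta]$, $\tilde M^\delta\subseteq X$ and $J^\delta$ is a functional on $X$, finite on $\tilde M^\delta$, with $J^\delta\ge0$ on $\tilde M^\delta$. Moreover $x^\dagger\in\tilde M^\delta$ and $J^\delta(x^\dagger)\le\eta(\delta)$ for all $\delta\in(0,\bar\delta)$, where $\eta(\delta)>0$ and $\eta(\delta)\to0$ as $\delta\to0$. For $x\in\tilde M^\delta$, $G^\delta(x):X\to\mathbb R$ is linear and $H^\delta(x):X^2\to\mathbb R$ is bilinear (approximations of gradient and Hessian of $J^\delta$); $H^\delta(x)h^2:=H^\delta(x)(h,h)$. $\mathcal R:X\to[0,\infty]$ is proper with domain $\operatorname{dom}(\mathcal R)\supseteq\bigcup_{\delta\in(0,\bar\delta)}\tilde M^\delta\cup M$. $x^*\in\bigcap_{\delta\in(0,\bar\delta)}\tilde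 M^\delta\cap M$ is a fixed point (a priori guess). Notation: given $x_k$, put $$Q_k^\delta(x)=J^\delta(x_k)+G^\delta(x_k)(x-x_k)+\tfrac12H^\delta(x_k)(x-x_k)^2,\qquad X_{k+1}(\alpha)=\operatorname{argmin}_{x\in\tilde M^\delta}\bigl(Q_k^\delta(x)+\alpha\mathcal R(x)\bigr).$$ It is assumed throughout that the mapping $\alpha\mapsto Q_k^\delta(X_{k+1}(\alpha))$ is single valued (i.e. $Q_k^\delta$ takes the same value at all minimizers in $X_{k+1}(\alpha)$), and $\sigma_k(\alpha):=Q_k^\delta(X_{k+1}(\alpha))/J^\delta(x_k)$. Iteration with a posteriori choice: given $x_k$ with $k<k_*(\delta)$ (so $J^\delta(x_k)>\tau\eta(\delta)>0$), - if $\underline\sigma<Q_k^\delta(x^* )/J^\delta(x_k)$, choose $\alpha_k$ with $\underline\sigma\le\sigma_k(\alpha_k)\le\overline\sigma$ and let $x_{k+1}$ be an arbitrary element of $X_{k+1}(\alpha_k)$; - otherwise set $x_{k+1}=x^*$. Assumption on existence of minimizers: for some topology $\mathcal T_0$ on $X$, (i) for all $r\ge\mathcal R(x^\dagger)$ the set $\{x\in\tilde M^\delta:\mathcal R(x)\le r\}$ is $\mathcal T_0$-compact; (ii) the mapping $Q_k^\delta+\alpha_k\mathcal R$ is $\mathcal T_0$-lower semicontinuous. Assumption for convergence: for some topology $\mathcal T$ on $X$, (i) the set $\{x\in\bigcup_{\delta\in(0,\bar\delta)}\tilde M^\delta:\mathcal R(x)\le R\}$ is $\mathcal T$-compact, with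 $$R=\Bigl(1+\tfrac{a-b}{\tau(a-b)-c}\,\tfrac{\tau b+c}{a\theta-b}\Bigr)\mathcal R(x^\dagger)+\tfrac{a-b}{\tau(a-b)-c}\,\tfrac{\tau b+c}{\alpha_0}\,J(x_0);$$ here $\tau$ is the constant in the definition of $k_*(\delta)$, $\alpha_0>0$ and $\theta\in(0,1)$ are the constants of an a priori rule $\alpha_k=\alpha_0\theta^k$ (a rule not otherwise used here), and $a>b\ge0$, $c\ge0$ are constants such that $$G^\delta(x)(x_+-x^\dagger)+\tfrac12H^\delta(x)(x_+-x)^2-\tfrac12H^\delta(x)(x-x^\dagger)^2\ \ge\ aJ^\delta(x_+)-bJ^\delta(x)-cJ^\delta(x^\dagger)$$ for all $x,x_+\in\tilde M^\delta$, $\delta\in(0,\bar\delta)$ (the two-sided bound in the claim implies this inequality with $a=\underline a$, $b=\underline b-\overline b$, $c=\overline a$); (ii) for all sequences $(z_n)\subseteq X$, $(\delta_n)\subseteq(0,\bar\delta]$ with $\delta_n\to0$: if $z_n\in\tilde M^{\delta_n}$ for all $n$ and $z_n\to z$ in $\mathcal T$, then $z\in M$; (iii) $\lim_{\delta\to0}\sup_{x\in\tilde M^\delta}(J(x)-J^\delta(x))\le0$; (iv) $J$ is $\mathcal T$-lower semicontinuous. Assumption on $x^*$ and $\mathcal R$: for some topology $\mathcal T_1$ on $X$, (i) $\mathcal R(x^* )=0$, and for any sequence $(x_j)\subseteq X$, $\mathcal R(x_j)\to0$ implies $x_j\to x^*$ in $\mathcal T_1$; (ii) sublevel sets of $\mathcal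 R$ are $\mathcal T_1$-compact; (iii) $\mathcal R$ is $\mathcal T_1$-lower semicontinuous; (iv) the mapping $x\mapsto G^\delta(x_k)(x-x_k)+\tfrac12H^\delta(x_k)(x-x_k)^2$ is $\mathcal T_1$-continuous; (v) $\tilde M^\delta$ is $\mathcal T_1$-closed.
   Formalization: "T-compact" in the convergence assumption is taken as sequentially compact, and both denominators τ(a−b)−c and aθ−b in the bound R are assumed positive; without either, claim (2) can fail. *)

theory Defs
  imports "HOL-Analysis.Analysis"
begin

text \<open>
  The topologies are abstract ones on a Banach space, unrelated to its norm topology, so
  the notions for topological types do not apply. The sequential notion of compactness is
  needed where a convergent subsequence is to be extracted; neither \<^const>\<open>compactin\<close> nor
  \<open>seq_compactin\<close> implies the other.
\<close>

definition lsc_map :: "'a topology \<Rightarrow> ('a \<Rightarrow> ereal) \<Rightarrow> bool" where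
  "lsc_map T f \<longleftrightarrow> (\<forall>c. openin T {x \<in> topspace T. c < f x})"

definition seq_compactin :: "'a topology \<Rightarrow> 'a set \<Rightarrow> bool" where
  "seq_compactin T S \<longleftrightarrow> S \<subseteq> topspace T \<and>
     (\<forall>f :: nat \<Rightarrow> 'a. range f \<subseteq> S \<longrightarrow>
        (\<exists>l\<in>S. \<exists>r :: nat \<Rightarrow> nat. strict_mono r \<and> limitin T (f \<circ> r) l sequentially))"

text \<open>
  In the following the noise level is fixed: \<open>Jd\<close>, \<open>G\<close>, \<open>H\<close>, \<open>Mt\<close> are the noisy functional, its
  approximate gradient and Hessian, and the admissible set at that level; \<open>y\<close> is the current
  iterate, \<open>xs\<close> the a priori guess, and \<open>tol\<close> stands for \<open>\<tau> * \<eta> \<delta>\<close>.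
\<close>

definition quad_model ::
  "('a::real_vector \<Rightarrow> ereal) \<Rightarrow> ('a \<Rightarrow> 'a \<Rightarrow> real) \<Rightarrow> ('a \<Rightarrow> 'a \<Rightarrow> 'a \<Rightarrow> real) \<Rightarrow> 'a \<Rightarrow> 'a \<Rightarrow> ereal"
  where "quad_model Jd G H y x = Jd y + ereal (G y (x - y) + 1/2 * H y (x - y) (x - y))"

definition reg_minimizers ::
  "('a::real_vector \<Rightarrow> ereal) \<Rightarrow> ('a \<Rightarrow> 'a \<Rightarrow> real) \<Rightarrow> ('a \<Rightarrow> 'a \<Rightarrow> 'a \<Rightarrow> real) \<Rightarrow> ('a \<Rightarrow> ereal) \<Rightarrow> 'a set
     \<Rightarrow> 'a \<Rightarrow> real \<Rightarrow> 'a set"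
  where "reg_minimizers Jd G H R Mt y \<alpha> =
    {x. is_arg_min (\<lambda>z. quad_model Jd G H y z + ereal \<alpha> * R z) (\<lambda>z. z \<in> Mt) x}"

text \<open>
  The value of the model on the set of minimizers is read off with \<^const>\<open>the_elem\<close>; it is
  meaningful where that set is nonempty and the model takes a single value on it.
\<close>

definition model_ratio ::
  "('a::real_vector \<Rightarrow> ereal) \<Rightarrow> ('a \<Rightarrow> 'a \<Rightarrow> real) \<Rightarrow> ('a \<Rightarrow> 'a \<Rightarrow> 'a \<Rightarrow> real) \<Rightarrow> ('a \<Rightarrow> ereal) \<Rightarrow> 'a set
     \<Rightarrow> 'a \<Rightarrow> real \<Rightarrow> ereal"
  where "model_ratio Jd G H R Mt y \<alpha> =
    the_elem (quad_model Jd G H y ` reg_minimizers Jd G H R Mt y \<alpha>) / Jd y"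

definition admissible_param ::
  "('a::real_vector \<Rightarrow> ereal) \<Rightarrow> ('a \<Rightarrow> 'a \<Rightarrow> real) \<Rightarrow> ('a \<Rightarrow> 'a \<Rightarrow> 'a \<Rightarrow> real) \<Rightarrow> ('a \<Rightarrow> ereal) \<Rightarrow> 'a set
     \<Rightarrow> real \<Rightarrow> real \<Rightarrow> 'a \<Rightarrow> real \<Rightarrow> bool"
  where "admissible_param Jd G H R Mt slo shi y \<alpha> \<longleftrightarrow>
    0 < \<alpha> \<and> reg_minimizers Jd G H R Mt y \<alpha> \<noteq> {} \<and>
    ereal slo \<le> model_ratio Jd G H R Mt y \<alpha> \<and> model_ratio Jd G H R Mt y \<alpha> \<le> ereal shi"

text \<open>Minimizers and parameters are not unique, so one step is a relation.\<close>

definition iter_step ::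
  "('a::real_vector \<Rightarrow> ereal) \<Rightarrow> ('a \<Rightarrow> 'a \<Rightarrow> real) \<Rightarrow> ('a \<Rightarrow> 'a \<Rightarrow> 'a \<Rightarrow> real) \<Rightarrow> ('a \<Rightarrow> ereal) \<Rightarrow> 'a set
     \<Rightarrow> 'a \<Rightarrow> real \<Rightarrow> real \<Rightarrow> 'a \<Rightarrow> 'a \<Rightarrow> bool"
  where "iter_step Jd G H R Mt xs slo shi y y' \<longleftrightarrow>
    (if ereal slo < quad_model Jd G H y xs / Jd y
     then \<exists>\<alpha>. admissible_param Jd G H R Mt slo shi y \<alpha> \<and> y' \<in> reg_minimizers Jd G H R Mt y \<alpha>
     else y' = xs)"

text \<open>The infimum over the empty set is \<open>\<infinity>\<close>: the stopping rule need not apply a priori.\<close>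

definition stop_index :: "('a \<Rightarrow> ereal) \<Rightarrow> real \<Rightarrow> (nat \<Rightarrow> 'a) \<Rightarrow> enat" where
  "stop_index Jd tol x = (INF k \<in> {k. Jd (x k) \<le> ereal tol}. enat k)"

text \<open>A complete run of the method; entries beyond the stopping index are arbitrary.\<close>

definition iteration ::
  "('a::real_vector \<Rightarrow> ereal) \<Rightarrow> ('a \<Rightarrow> 'a \<Rightarrow> real) \<Rightarrow> ('a \<Rightarrow> 'a \<Rightarrow> 'a \<Rightarrow> real) \<Rightarrow> ('a \<Rightarrow> ereal) \<Rightarrow> 'a set
     \<Rightarrow> 'a \<Rightarrow> real \<Rightarrow> real \<Rightarrow> real \<Rightarrow> 'a \<Rightarrow> (nat \<Rightarrow> 'a) \<Rightarrow> bool"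
  where "iteration Jd G H R Mt xs slo shi tol x0 x \<longleftrightarrow>
    x 0 = x0 \<and>
    (\<forall>k. enat k < stop_index Jd tol x \<longrightarrow> iter_step Jd G H R Mt xs slo shi (x k) (x (Suc k)))"

text \<open>
  \<open>y\<close> occurs as some \<open>x n\<close> with \<open>n\<close> below the stopping index in a (possibly only partial) run,
  i.e. a further step has to be carried out at \<open>y\<close>.
\<close>

definition active_iterate ::
  "('a::real_vector \<Rightarrow> ereal) \<Rightarrow> ('a \<Rightarrow> 'a \<Rightarrow> real) \<Rightarrow> ('a \<Rightarrow> 'a \<Rightarrow> 'a \<Rightarrow> real) \<Rightarrow> ('a \<Rightarrow> ereal) \<Rightarrow> 'a set
     \<Rightarrow> 'a \<Rightarrow> real \<Rightarrow> real \<Rightarrow> real \<Rightarrow> 'a \<Rightarrow> 'a \<Rightarrow> bool"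
  where "active_iterate Jd G H R Mt xs slo shi tol x0 y \<longleftrightarrow>
    (\<exists>x n. x 0 = x0 \<and>
       (\<forall>k<n. iter_step Jd G H R Mt xs slo shi (x k) (x (Suc k))) \<and>
       enat n < stop_index Jd tol x \<and> y = x n)"

end

theory Submission
  imports Defs
begin

text \<open>
  The lower bound in the two-sided estimate bounds the model below, so regularized minimizers
  over \<open>\<T>\<^sub>1\<close>-closed subsets of the admissible set exist. The upper bound and the condition on
  \<open>\<tau>\<close> put the model at every \<open>x\<close> with \<open>J\<^sup>\<delta>(x) \<le> \<eta>(\<delta>)\<close> strictly below \<open>\<sigma> J\<^sup>\<delta>(x\<^sub>k)\<close>,
  where \<open>\<sigma>\<close> is the lower threshold. Hence the parameter can be chosen such that the model at the
  minimizers equals \<open>\<sigma> J\<^sup>\<delta>(x\<^sub>k)\<close>: it is found by the intermediate value theorem, applied to the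
  difference of the regularized minima below and above this level. At such near-solutions the
  model is smaller than at \<open>x\<^bsub>k+1\<^esub>\<close>, so minimality forces the penalty to be larger there.
  The lower bound turns the upper threshold for the model into geometric decay of \<open>J\<^sup>\<delta>(x\<^sub>k)\<close>,
  and the stopping rule then gives convergence by compactness and semicontinuity.
\<close>

section \<open>Lower semicontinuity with respect to an abstract topology\<close>

lemma lsc_map_ereal_continuous:
  assumes "continuous_map T euclideanreal q"
  shows "lsc_map T (\<lambda>x. ereal (q x))"
  unfolding lsc_map_def
proof
  fix c :: ereal
  show "openin T {x \<in> topspace T. c < ereal (q x)}"
  proof (cases c)
    case (real r)
    then show ?thesis
      using openin_continuous_map_preimage[OF assms, of "{r<..}"] by simp
  qed auto
qed

text \<open>A sum exceeds a real level iff the level splits into two reals exceeded by the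
  respective summands, so superlevel sets are unions of intersections of open sets. Excluding
  \<open>-\<infinity>\<close> rules out sums of opposite infinities.\<close>

lemma lsc_map_add:
  assumes f: "lsc_map T f" "\<And>x. f x \<noteq> -\<infinity>" and g: "lsc_map T g" "\<And>x. g x \<noteq> -\<infinity>"
  shows "lsc_map T (\<lambda>x. f x + g x)"
  unfolding lsc_map_def
proof
  fix c :: ereal
  show "openin T {x \<in> topspace T. c < f x + g x}"
  proof (cases c)
    case (real r)
    have "c < f x + g x \<longleftrightarrow> (\<exists>t. ereal t < f x \<and> ereal (r - t) < g x)" for x
    proof
      assume *: "c < f x + g x"
      show "\<exists>t. ereal t < f x \<and> ereal (r - t) < g x"
      proof (cases "f x")
        case (real p)
        then show ?thesis
        proof (cases "g x")
          fix w assume g: "g x = ereal w"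
          with * real \<open>c = ereal r\<close> have "r < p + w" by simp
          \<comment> \<open>The excess \<open>p + w - r\<close> over the level is shared equally
            between the two summands.\<close>
          then have "p - (p + w - r) / 2 < p" "r - (p - (p + w - r) / 2) < w"
            by (auto simp: field_simps)
          then show ?thesis using real g by (metis ereal_less(1) less_ereal.simps(1))
        next
          assume "g x = \<infinity>"
          then show ?thesis using real by (intro exI[of _ "p - 1"]) simp
        qed (use g in auto)
      next
        case PInf
        then show ?thesis
        proof (cases "g x")
          fix w assume "g x = ereal w"
          then show ?thesis using PInf by (intro exI[of _ "r - w + 1"]) simp
        qed (use g in auto)
      qed (use f in auto)
    next
      assume "\<exists>t. ereal t < f x \<and> ereal (r - t) < g x"
      then obtain t where "ereal t < f x" "ereal (r - t) < g x" by blast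
      then have "ereal t + ereal (r - t) < f x + g x"
        by (rule ereal_add_strict_mono2)
      then show "c < f x + g x" by (simp add: real)
    qed
    then have "{x \<in> topspace T. c < f x + g x} =
        (\<Union>t. {x \<in> topspace T. ereal t < f x} \<inter> {x \<in> topspace T. ereal (r - t) < g x})"
      by auto
    moreover have "openin T \<dots>"
      using f(1) g(1) unfolding lsc_map_def by (intro openin_Union) auto
    ultimately show ?thesis by simp
  next
    case MInf
    have "{x \<in> topspace T. c < f x + g x} = topspace T"
      using f(2) g(2) MInf by (auto simp: less_le ereal_plus_eq_MInfty)
    then show ?thesis by simp
  qed auto
qed

lemma lsc_map_cmult:
  assumes "lsc_map T f" "0 < \<alpha>"
  shows "lsc_map T (\<lambda>x. ereal \<alpha> * f x)"
  unfolding lsc_map_def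
proof
  fix c :: ereal
  have "c < ereal \<alpha> * f x \<longleftrightarrow> c / ereal \<alpha> < f x" for x
    using ereal_divide_less_iff[of "ereal \<alpha>" c "f x"] \<open>0 < \<alpha>\<close> by (simp add: mult.commute)
  then show "openin T {x \<in> topspace T. c < ereal \<alpha> * f x}"
    using assms by (simp add: lsc_map_def)
qed

text \<open>Without a minimum, the open sets \<open>U y\<close> of points with value above
  \<open>f y\<close>, for \<open>y\<close> in \<open>S\<close>, cover \<open>S\<close>. A minimizer
  of \<open>f\<close> over the finite index set of a subcover lies in none of the chosen
  sets.\<close>

lemma lsc_map_attains_min:
  assumes "lsc_map T f" "compactin T S" "S \<noteq> {}"
  shows "\<exists>x\<in>S. \<forall>y\<in>S. f x \<le> f y"
proof (rule ccontr)
  assume no_min: "\<not> ?thesis"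
  define U where "U y = {x \<in> topspace T. f y < f x}" for y
  have "\<forall>u\<in>U ` S. openin T u" "S \<subseteq> \<Union>(U ` S)"
    using assms(1) compactin_subset_topspace[OF assms(2)] no_min
    by (auto simp: U_def lsc_map_def not_le)
  with assms(2) obtain F where F: "finite F" "F \<subseteq> U ` S" "S \<subseteq> \<Union>F"
    unfolding compactin_def by meson
  then obtain Y where Y: "finite Y" "Y \<subseteq> S" "F = U ` Y"
    by (meson finite_subset_image)
  with F assms(3) have "Y \<noteq> {}" by auto
  then have "arg_min_on f Y \<in> Y" "\<forall>y\<in>Y. f (arg_min_on f Y) \<le> f y"
    using Y(1) by (auto simp: arg_min_if_finite arg_min_least)
  with Y F show False by (force simp: U_def)
qed


section \<open>Minimization of \<open>q + \<alpha> * pen\<close> over closed sets\<close>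

locale tikhonov_functional =
  fixes T :: "'a topology" and q :: "'a \<Rightarrow> real" and \<rho> :: "'a \<Rightarrow> ereal" and K :: "'a set"
    and m :: real
  assumes continuous_q: "continuous_map T euclideanreal q"
    and lsc_penalty: "lsc_map T \<rho>"
    and penalty_nonneg: "0 \<le> \<rho> x"
    and compact_sublevel: "compactin T {x. \<rho> x \<le> ereal r}"
    and closed_K: "closedin T K"
    and penalty_finite: "x \<in> K \<Longrightarrow> \<rho> x < \<infinity>"
    and q_bounded_below: "x \<in> K \<Longrightarrow> m \<le> q x"
begin

text \<open>\<open>real_of_ereal\<close> maps \<open>\<infinity>\<close> to 0, so \<open>pen\<close>
  represents \<open>\<rho>\<close> only where the latter is finite, which is guaranteed on
  \<open>K\<close>.\<close>

abbreviation pen :: "'a \<Rightarrow> real" where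
  "pen x \<equiv> real_of_ereal (\<rho> x)"

lemma penalty_eq: "x \<in> K \<Longrightarrow> \<rho> x = ereal (pen x)"
  using penalty_finite[of x] penalty_nonneg[of x] by (cases "\<rho> x") auto

lemma pen_nonneg: "0 \<le> pen x"
  using penalty_nonneg by (simp add: real_of_ereal_pos)

text \<open>As \<open>q\<close> is bounded below, points with large penalty lose against any fixed
  \<open>w\<close>, and the search reduces to a compact part of \<open>D\<close>. General closed
  \<open>D\<close> are allowed in order to treat the parts of \<open>K\<close> below and above a
  level of \<open>q\<close> separately.\<close>

lemma exists_minimizer:
  assumes D: "closedin T D" "D \<subseteq> K" "D \<noteq> {}" and "0 < \<alpha>"
  shows "\<exists>x\<in>D. \<forall>z\<in>D. q x + \<alpha> * pen x \<le> q z + \<alpha> * pen z"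
proof -
  let ?f = "\<lambda>x. ereal (q x) + ereal \<alpha> * \<rho> x"
  have f_eq: "?f x = ereal (q x + \<alpha> * pen x)" if "x \<in> D" for x
    using penalty_eq[of x] that D(2) by (metis plus_ereal.simps(1) subsetD times_ereal.simps(1))
  have "ereal \<alpha> * \<rho> x \<noteq> -\<infinity>" for x
    using penalty_nonneg[of x] \<open>0 < \<alpha>\<close> by (cases "\<rho> x") auto
  then have lsc: "lsc_map T ?f"
    using lsc_map_add lsc_map_ereal_continuous[OF continuous_q]
      lsc_map_cmult[OF lsc_penalty \<open>0 < \<alpha>\<close>] by (metis MInfty_neq_ereal(1))
  obtain w where w: "w \<in> D" using D(3) by blast
  \<comment> \<open>If \<open>pen x > r\<close>, then \<open>m \<le> q x\<close> makes the
    functional at \<open>x\<close> larger than at \<open>w\<close>.\<close>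
  define r where "r = (q w + \<alpha> * pen w - m) / \<alpha>"
  define S where "S = D \<inter> {x. \<rho> x \<le> ereal r}"
  have S_iff: "x \<in> S \<longleftrightarrow> \<alpha> * pen x \<le> q w + \<alpha> * pen w - m" if "x \<in> D" for x
  proof -
    have "x \<in> S \<longleftrightarrow> pen x \<le> r"
      using that D(2) penalty_eq[of x] unfolding S_def by (metis (mono_tags, lifting) Int_iff ereal_less_eq(3) mem_Collect_eq subsetD)
    then show ?thesis using \<open>0 < \<alpha>\<close> by (simp add: r_def field_simps)
  qed
  have "compactin T S"
    unfolding S_def by (rule closed_Int_compactin[OF D(1) compact_sublevel])
  moreover have "w \<in> S"
    using w D(2) q_bounded_below[of w] by (auto simp: S_iff)
  ultimately obtain x where x: "x \<in> S" "\<And>z. z \<in> S \<Longrightarrow> ?f x \<le> ?f z"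
    using lsc_map_attains_min[OF lsc] by blast
  have xD: "x \<in> D" using x(1) by (simp add: S_def)
  have "q x + \<alpha> * pen x \<le> q z + \<alpha> * pen z" if z: "z \<in> D" for z
  proof (cases "z \<in> S")
    case True
    then show ?thesis using x(2)[of z] f_eq[OF z] f_eq[OF xD] by simp
  next
    case False
    then have "q w + \<alpha> * pen w < m + \<alpha> * pen z" using z by (simp add: S_iff)
    also have "\<dots> \<le> q z + \<alpha> * pen z" using q_bounded_below z D(2) by auto
    finally show ?thesis using x(2)[OF \<open>w \<in> S\<close>] f_eq[OF w] f_eq[OF xD] by simp
  qed
  then show ?thesis using xD by blast
qed

text \<open>As an infimum of affine functions of \<open>\<alpha>\<close> the value function is concave.\<close>

lemma continuous_value_function:
  assumes D: "closedin T D" "D \<subseteq> K" "D \<noteq> {}"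
  obtains v where "continuous_on {0<..} v"
    and "\<And>\<alpha>. 0 < \<alpha> \<Longrightarrow> \<exists>x\<in>D. v \<alpha> = q x + \<alpha> * pen x"
    and "\<And>\<alpha> z. 0 < \<alpha> \<Longrightarrow> z \<in> D \<Longrightarrow> v \<alpha> \<le> q z + \<alpha> * pen z"
proof -
  obtain x where x: "\<And>\<alpha>. 0 < \<alpha> \<Longrightarrow> x \<alpha> \<in> D"
      "\<And>\<alpha> z. 0 < \<alpha> \<Longrightarrow> z \<in> D \<Longrightarrow> q (x \<alpha>) + \<alpha> * pen (x \<alpha>) \<le> q z + \<alpha> * pen z"
    using exists_minimizer[OF D] by metis
  define v where "v \<alpha> = q (x \<alpha>) + \<alpha> * pen (x \<alpha>)" for \<alpha>
  have "convex_on {0<..} (\<lambda>\<alpha>. - v \<alpha>)"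
  proof
    fix t \<alpha> \<beta> :: real
    assume t: "0 < t" "t < 1" and pos: "\<alpha> \<in> {0<..}" "\<beta> \<in> {0<..}"
    define \<gamma> where "\<gamma> = (1 - t) * \<alpha> + t * \<beta>"
    have "0 < \<gamma>" using t pos by (auto simp: \<gamma>_def intro!: add_pos_pos)
    \<comment> \<open>The minimizer for the intermediate parameter \<open>\<gamma>\<close> competes
      at both \<open>\<alpha>\<close> and \<open>\<beta>\<close>, and at a fixed point the
      functional is affine in the parameter.\<close>
    then have "(1 - t) * v \<alpha> \<le> (1 - t) * (q (x \<gamma>) + \<alpha> * pen (x \<gamma>))"
      and "t * v \<beta> \<le> t * (q (x \<gamma>) + \<beta> * pen (x \<gamma>))"
      using t pos x by (auto simp: v_def intro!: mult_left_mono)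
    then have "(1 - t) * v \<alpha> + t * v \<beta> \<le> v \<gamma>"
      by (simp add: v_def \<gamma>_def algebra_simps)
    then show "- v ((1 - t) *\<^sub>R \<alpha> + t *\<^sub>R \<beta>) \<le> (1 - t) * - v \<alpha> + t * - v \<beta>"
      by (simp add: \<gamma>_def)
  qed simp
  then have "continuous_on {0<..} (\<lambda>\<alpha>. - (- v \<alpha>))"
    by (intro continuous_on_minus convex_on_continuous) auto
  then show thesis
    using that[of v] x unfolding v_def minus_minus by blast
qed

text \<open>
  The regularized minima over \<open>{q \<le> s}\<close> and over \<open>{q \<ge> s}\<close> depend continuously on \<open>\<alpha>\<close>, the
  former is the smaller one for small \<open>\<alpha>\<close> and the latter for large \<open>\<alpha>\<close>. Where they agree,
  both are minima over \<open>K\<close>.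
\<close>

lemma exists_balanced_parameter:
  assumes w: "w \<in> K" "q w < s" and u: "u \<in> K" "s < q u" "\<rho> u = 0"
    and conv: "\<And>z :: nat \<Rightarrow> 'a. (\<lambda>j. \<rho> (z j)) \<longlonglongrightarrow> 0 \<Longrightarrow> limitin T z u sequentially"
  obtains \<alpha> x y where "0 < \<alpha>" "x \<in> K" "y \<in> K" "q x \<le> s" "s \<le> q y"
    and "\<And>z. z \<in> K \<Longrightarrow> q x + \<alpha> * pen x \<le> q z + \<alpha> * pen z"
    and "\<And>z. z \<in> K \<Longrightarrow> q y + \<alpha> * pen y \<le> q z + \<alpha> * pen z"
proof -
  define L where "L = {x \<in> K. q x \<le> s}"
  define U where "U = {x \<in> K. s \<le> q x}"
  have *: "closedin T {x \<in> topspace T. q x \<le> s}" "closedin T {x \<in> topspace T. s \<le> q x}"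
    using continuous_q by (auto simp: continuous_map_upper_lower_semicontinuous_le)
  have "L = K \<inter> {x \<in> topspace T. q x \<le> s}" "U = K \<inter> {x \<in> topspace T. s \<le> q x}"
    using closedin_subset[OF closed_K] by (auto simp: L_def U_def)
  then have closed: "closedin T L" "closedin T U"
    using closed_K * by auto
  have sub: "L \<subseteq> K" "U \<subseteq> K" "K \<subseteq> L \<union> U" by (auto simp: L_def U_def)
  have mem: "w \<in> L" "u \<in> U" using w u by (auto simp: L_def U_def)
  obtain vL where vL: "continuous_on {0<..} vL"
      "\<And>\<alpha>. 0 < \<alpha> \<Longrightarrow> \<exists>x\<in>L. vL \<alpha> = q x + \<alpha> * pen x"
      "\<And>\<alpha> z. 0 < \<alpha> \<Longrightarrow> z \<in> L \<Longrightarrow> vL \<alpha> \<le> q z + \<alpha> * pen z"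
    using continuous_value_function[of L] closed sub mem by blast
  obtain vU where vU: "continuous_on {0<..} vU"
      "\<And>\<alpha>. 0 < \<alpha> \<Longrightarrow> \<exists>x\<in>U. vU \<alpha> = q x + \<alpha> * pen x"
      "\<And>\<alpha> z. 0 < \<alpha> \<Longrightarrow> z \<in> U \<Longrightarrow> vU \<alpha> \<le> q z + \<alpha> * pen z"
    using continuous_value_function[of U] closed sub mem by blast
  \<comment> \<open>Chosen so that the functional at \<open>w\<close> is at most \<open>s\<close>, a
    lower bound for it on \<open>U\<close>. The summand 1 keeps the denominator positive when
    \<open>pen w = 0\<close>.\<close>
  define lo where "lo = (s - q w) / (pen w + 1)"
  have "0 < pen w + 1" using pen_nonneg[of w] by simp
  then have lo: "0 < lo" "lo * pen w \<le> s - q w"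
    using w(2) pen_nonneg[of w] by (auto simp: lo_def field_simps)
  have below: "vL lo \<le> vU lo"
  proof -
    obtain x where "x \<in> U" "vU lo = q x + lo * pen x" using vU(2) lo(1) by blast
    then have "s \<le> vU lo" using lo(1) pen_nonneg[of x] by (auto simp: U_def intro: add_increasing2)
    then show ?thesis using vL(3)[OF lo(1) mem(1)] lo(2) by simp
  qed
  \<comment> \<open>Otherwise, for each parameter \<open>n + 1\<close>, the minimum over
    \<open>L\<close> stays below \<open>q u\<close>, the value at the unpenalized \<open>u\<close>.
    The penalties of the minimizers then tend to 0, so the minimizers tend to \<open>u\<close>; as
    \<open>L\<close> is closed, \<open>u\<close> lies in \<open>L\<close>, against
    \<open>s < q u\<close>.\<close>
  have "\<exists>hi>0. vU hi \<le> vL hi"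
  proof (rule ccontr)
    assume "\<not> ?thesis"
    then have "vL \<alpha> < vU \<alpha>" if "0 < \<alpha>" for \<alpha> using that by force
    moreover have "vU \<alpha> \<le> q u" if "0 < \<alpha>" for \<alpha>
      using vU(3)[OF that mem(2)] u(3) by simp
    ultimately have "vL (real (Suc n)) < q u" for n
      by (metis less_le_trans of_nat_0_less_iff zero_less_Suc)
    then have "\<exists>x\<in>L. q x + real (Suc n) * pen x < q u" for n
      using vL(2)[of "real (Suc n)"] by (metis of_nat_0_less_iff zero_less_Suc)
    then obtain x where x: "\<And>n. x n \<in> L" "\<And>n. q (x n) + real (Suc n) * pen (x n) < q u"
      by metis
    have "pen (x n) \<le> (q u - m) / real (Suc n)" for n
      using x(2)[of n] q_bounded_below[of "x n"] x(1)[of n] sub(1)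
      by (auto simp: pos_le_divide_eq algebra_simps subset_iff simp del: of_nat_Suc)
    moreover have "(\<lambda>n. (q u - m) / real (Suc n)) \<longlonglongrightarrow> 0"
      by (rule LIMSEQ_Suc[OF lim_const_over_n])
    ultimately have "(\<lambda>n. pen (x n)) \<longlonglongrightarrow> 0"
      by (rule_tac real_tendsto_sandwich[OF _ _ tendsto_const])
         (auto simp: pen_nonneg)
    then have "(\<lambda>n. ereal (pen (x n))) \<longlonglongrightarrow> 0"
      by (simp add: zero_ereal_def)
    moreover have "\<rho> (x n) = ereal (pen (x n))" for n
      using penalty_eq x(1) sub(1) by blast
    ultimately have "limitin T x u sequentially"
      using conv[of x] by simp
    then have "u \<in> L"
      using limitin_closedin[OF _ closed(1)] x(1) by (metis eventuallyI sequentially_bot)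
    then show False using u(2) by (simp add: L_def)
  qed
  then obtain hi where hi: "0 < hi" "vU hi \<le> vL hi" by blast
  have cont: "continuous_on {0<..} (\<lambda>\<alpha>. vL \<alpha> - vU \<alpha>)"
    using vL(1) vU(1) by (intro continuous_on_diff)
  \<comment> \<open>Connectedness of the whole image gives a zero whichever of \<open>lo\<close> and
    \<open>hi\<close> is larger.\<close>
  have "connected ((\<lambda>\<alpha>. vL \<alpha> - vU \<alpha>) ` {0<..})"
    by (rule connected_continuous_image[OF cont]) (simp add: is_interval_connected)
  then have "0 \<in> (\<lambda>\<alpha>. vL \<alpha> - vU \<alpha>) ` {0<..}"
    using below hi lo(1) connectedD_interval[of "(\<lambda>\<alpha>. vL \<alpha> - vU \<alpha>) ` {0<..}"
        "vL lo - vU lo" "vL hi - vU hi" 0] by simp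
  then obtain \<alpha> where \<alpha>: "0 < \<alpha>" "vL \<alpha> = vU \<alpha>" by auto
  obtain x y where xy: "x \<in> L" "vL \<alpha> = q x + \<alpha> * pen x" "y \<in> U" "vU \<alpha> = q y + \<alpha> * pen y"
    using vL(2) vU(2) \<alpha>(1) by metis
  have "vL \<alpha> \<le> q z + \<alpha> * pen z" if "z \<in> K" for z
    using that sub(3) vL(3)[OF \<alpha>(1)] vU(3)[OF \<alpha>(1)] \<alpha>(2) by auto
  then show thesis
    using that[OF \<alpha>(1), of x y] xy \<alpha>(2) by (auto simp: L_def U_def)
qed

end


section \<open>Single steps at a fixed noise level\<close>

locale noisy_problem =
  fixes Jd :: "'a::real_vector \<Rightarrow> ereal" and G :: "'a \<Rightarrow> 'a \<Rightarrow> real"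
    and H :: "'a \<Rightarrow> 'a \<Rightarrow> 'a \<Rightarrow> real" and R :: "'a \<Rightarrow> ereal" and Mt S :: "'a set"
    and xs xd :: 'a and T1 :: "'a topology" and slo shi \<tau> e al bl au bu :: real
  assumes Jd_finite: "x \<in> Mt \<Longrightarrow> \<bar>Jd x\<bar> \<noteq> \<infinity>"
    and Jd_nonneg: "x \<in> Mt \<Longrightarrow> 0 \<le> Jd x"
    and xd_mem: "xd \<in> Mt" and Jd_xd: "Jd xd \<le> ereal e"
    and e_pos: "0 < e" and tau: "1 < \<tau>"
    and R_nonneg: "0 \<le> R x"
    and R_finite: "x \<in> Mt \<Longrightarrow> R x < \<infinity>"
    and xs_mem: "xs \<in> Mt" and R_xs: "R xs = 0"
    and starts: "S \<subseteq> Mt"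
    and T1_conv: "\<And>z :: nat \<Rightarrow> 'a. (\<lambda>j. R (z j)) \<longlonglongrightarrow> 0 \<Longrightarrow> limitin T1 z xs sequentially"
    and T1_compact: "compactin T1 {x. R x \<le> ereal r}"
    and T1_lsc: "lsc_map T1 R"
    and T1_closed: "closedin T1 Mt"
    and T1_cont: "s \<in> S \<Longrightarrow> active_iterate Jd G H R Mt xs slo shi (\<tau> * e) s y \<Longrightarrow>
      continuous_map T1 euclideanreal (\<lambda>x. G y (x - y) + 1/2 * H y (x - y) (x - y))"
    and single_valued: "s \<in> S \<Longrightarrow> active_iterate Jd G H R Mt xs slo shi (\<tau> * e) s y \<Longrightarrow>
      0 < \<alpha> \<Longrightarrow> u \<in> reg_minimizers Jd G H R Mt y \<alpha> \<Longrightarrow> v \<in> reg_minimizers Jd G H R Mt y \<alpha> \<Longrightarrow>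
      quad_model Jd G H y u = quad_model Jd G H y v"
    and two_sided: "x \<in> Mt \<Longrightarrow> xp \<in> Mt \<Longrightarrow>
      ereal al * Jd xp - ereal bl * Jd x
        \<le> ereal (G x (xp - x) + 1/2 * H x (xp - x) (xp - x)) \<and>
      ereal (G x (xp - x) + 1/2 * H x (xp - x) (xp - x))
        \<le> ereal au * Jd xp - ereal bu * Jd x"
    and consts_nonneg: "0 \<le> al" "0 \<le> au"
    and sigma: "0 < slo" "slo < shi"
    and param1: "1 + au / \<tau> < slo + bu"
    and param2: "shi + bl < 1 + al"
begin

abbreviation active :: "'a \<Rightarrow> 'a \<Rightarrow> bool" where
  "active \<equiv> active_iterate Jd G H R Mt xs slo shi (\<tau> * e)"

abbreviation step :: "'a \<Rightarrow> 'a \<Rightarrow> bool" where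
  "step \<equiv> iter_step Jd G H R Mt xs slo shi"

abbreviation stop :: "(nat \<Rightarrow> 'a) \<Rightarrow> enat" where
  "stop \<equiv> stop_index Jd (\<tau> * e)"

abbreviation minimizers :: "'a \<Rightarrow> real \<Rightarrow> 'a set" where
  "minimizers \<equiv> reg_minimizers Jd G H R Mt"

abbreviation admissible :: "'a \<Rightarrow> real \<Rightarrow> bool" where
  "admissible \<equiv> admissible_param Jd G H R Mt slo shi"

text \<open>\<open>val\<close>, \<open>model\<close> and \<open>pen\<close> are real counterparts of
  \<open>Jd\<close>, \<open>quad_model\<close> and \<open>R\<close>. They are faithful on
  \<open>Mt\<close>; for \<open>model\<close> it suffices that the base point lies there.\<close>

definition val :: "'a \<Rightarrow> real" where
  "val x = real_of_ereal (Jd x)"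

definition model :: "'a \<Rightarrow> 'a \<Rightarrow> real" where
  "model y x = val y + (G y (x - y) + 1/2 * H y (x - y) (x - y))"

definition pen :: "'a \<Rightarrow> real" where
  "pen x = real_of_ereal (R x)"

lemma Jd_eq: "x \<in> Mt \<Longrightarrow> Jd x = ereal (val x)"
  using Jd_finite[of x] by (simp add: val_def ereal_real)

lemma val_nonneg: "x \<in> Mt \<Longrightarrow> 0 \<le> val x"
  using Jd_nonneg[of x] by (simp add: val_def real_of_ereal_pos)

lemma R_eq: "x \<in> Mt \<Longrightarrow> R x = ereal (pen x)"
  using R_finite[of x] R_nonneg[of x] by (cases "R x") (auto simp: pen_def)

lemma quad_model_eq: "y \<in> Mt \<Longrightarrow> quad_model Jd G H y x = ereal (model y x)"
  by (simp add: quad_model_def model_def Jd_eq)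

lemma model_bounds:
  assumes "y \<in> Mt" "x \<in> Mt"
  shows "(1 - bl) * val y + al * val x \<le> model y x"
    and "model y x \<le> (1 - bu) * val y + au * val x"
  using two_sided[OF assms] assms by (simp_all add: Jd_eq model_def algebra_simps)

lemma mem_minimizers_iff:
  assumes "y \<in> Mt"
  shows "x \<in> minimizers y \<alpha> \<longleftrightarrow>
    x \<in> Mt \<and> (\<forall>z\<in>Mt. model y x + \<alpha> * pen x \<le> model y z + \<alpha> * pen z)"
  using assms by (auto simp: reg_minimizers_def is_arg_min_def quad_model_eq R_eq not_less)

lemma step_mem: "step y y' \<Longrightarrow> y' \<in> Mt"
  using xs_mem by (auto simp: iter_step_def reg_minimizers_def is_arg_min_def split: if_splits)

lemma run_mem:
  assumes "x 0 \<in> S" "\<forall>k<n. step (x k) (x (Suc k))"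
  shows "x n \<in> Mt"
  using assms starts by (cases n) (auto dest: step_mem)

lemma less_stop_indexD:
  assumes "enat n < stop x" "k \<le> n"
  shows "ereal (\<tau> * e) < Jd (x k)"
proof (rule ccontr)
  assume "\<not> ?thesis"
  then have "stop x \<le> enat k"
    unfolding stop_index_def by (intro INF_lower) auto
  also have "\<dots> \<le> enat n" using assms(2) by simp
  finally show False using assms(1) by simp
qed

text \<open>A finite infimum belongs to a nonempty set of indices, and by well-ordering such a set
  attains it.\<close>

lemma stop_index_eq_enatD:
  assumes "stop x = enat n"
  shows "Jd (x n) \<le> ereal (\<tau> * e)"
proof -
  let ?A = "enat ` {k. Jd (x k) \<le> ereal (\<tau> * e)}"
  have "?A \<noteq> {}" using assms by (metis Inf_empty enat.distinct(1) infinity_enat_def stop_index_def top_enat_def)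
  then obtain k where "k \<in> ?A" by blast
  then have "Inf ?A \<in> ?A"
    unfolding Inf_enat_def by (auto intro: LeastI)
  then show ?thesis using assms by (auto simp: stop_index_def)
qed

lemma activeD:
  assumes "s \<in> S" "active s y"
  shows "y \<in> Mt" "\<tau> * e < val y" "0 < val y"
proof -
  obtain x n where x: "x 0 = s" "\<forall>k<n. step (x k) (x (Suc k))" "enat n < stop x" "y = x n"
    using assms(2) unfolding active_iterate_def by blast
  show mem: "y \<in> Mt" using run_mem[of x n] x assms(1) by simp
  show "\<tau> * e < val y" using less_stop_indexD[OF x(3), of n] x(4) mem by (simp add: Jd_eq)
  then show "0 < val y" using e_pos tau by (smt (verit) mult_pos_pos)
qed

text \<open>At an active \<open>y\<close> one has \<open>e < val y / \<tau>\<close>, which turns the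
  term \<open>au * val x\<close> of the upper bound into at most \<open>au / \<tau> * val y\<close>;
  \<open>param1\<close> then says exactly that the total factor is below \<open>slo\<close>.\<close>

lemma model_less_if_near_solution:
  assumes "s \<in> S" "active s y" "x \<in> Mt" "Jd x \<le> ereal e"
  shows "model y x < slo * val y"
proof -
  note y = activeD[OF assms(1,2)]
  have "val x \<le> e" using assms by (simp add: Jd_eq)
  also have "e \<le> val y / \<tau>" using y(2) tau by (simp add: field_simps)
  finally have "au * val x \<le> au / \<tau> * val y"
    using consts_nonneg(2) mult_left_mono by fastforce
  then have "model y x \<le> (1 - bu + au / \<tau>) * val y"
    using model_bounds(2)[OF y(1) assms(3)] by (simp add: algebra_simps)
  also have "\<dots> < slo * val y" using param1 y(3) by (intro mult_strict_right_mono) auto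
  finally show ?thesis .
qed

text \<open>Single-valuedness makes the image under \<open>the_elem\<close> a singleton, so the
  ratio can be read off at any minimizer; \<open>val y > 0\<close> clears the denominator.\<close>

lemma admissible_iff:
  assumes "s \<in> S" "active s y" "0 < \<alpha>" "x \<in> minimizers y \<alpha>"
  shows "admissible y \<alpha> \<longleftrightarrow> slo * val y \<le> model y x \<and> model y x \<le> shi * val y"
proof -
  note y = activeD[OF assms(1,2)]
  have "quad_model Jd G H y ` minimizers y \<alpha> = {quad_model Jd G H y x}"
    using single_valued[OF assms(1-3) _ assms(4)] assms(4) by blast
  then have "model_ratio Jd G H R Mt y \<alpha> = ereal (model y x / val y)"
    using y by (simp add: model_ratio_def quad_model_eq Jd_eq)
  then show ?thesis
    using y(3) assms(3,4) by (auto simp: admissible_param_def field_simps)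
qed

lemma guess_condition_iff:
  assumes "s \<in> S" "active s y"
  shows "ereal slo < quad_model Jd G H y xs / Jd y \<longleftrightarrow> slo * val y < model y xs"
  using activeD[OF assms] by (simp add: quad_model_eq Jd_eq field_simps)

text \<open>The level is \<open>slo * val y\<close>: \<open>xd\<close> lies strictly below it, and
  the hypothesis on the guess puts the unpenalized \<open>xs\<close> strictly above it.\<close>

lemma exists_admissible:
  assumes act: "s \<in> S" "active s y" and guess: "ereal slo < quad_model Jd G H y xs / Jd y"
  shows "\<exists>\<alpha>. admissible y \<alpha>"
proof -
  note y = activeD[OF act]
  interpret reg: tikhonov_functional T1 "model y" R Mt "(1 - bl) * val y"
  proof
    show "continuous_map T1 euclideanreal (model y)"
      unfolding model_def by (intro continuous_map_add T1_cont[OF act]) simp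
    show "(1 - bl) * val y \<le> model y x" if "x \<in> Mt" for x
      using model_bounds(1)[OF y(1) that] val_nonneg[OF that] consts_nonneg(1)
      by (smt (verit) mult_nonneg_nonneg)
  qed (use T1_lsc R_nonneg T1_compact T1_closed R_finite in auto)
  obtain \<alpha> u v where *: "0 < \<alpha>" "u \<in> Mt" "v \<in> Mt" "model y u \<le> slo * val y" "slo * val y \<le> model y v"
    "\<And>z. z \<in> Mt \<Longrightarrow> model y u + \<alpha> * pen u \<le> model y z + \<alpha> * pen z"
    "\<And>z. z \<in> Mt \<Longrightarrow> model y v + \<alpha> * pen v \<le> model y z + \<alpha> * pen z"
    using reg.exists_balanced_parameter[OF xd_mem model_less_if_near_solution[OF act xd_mem Jd_xd] xs_mem _ R_xs T1_conv]
      guess guess_condition_iff[OF act] unfolding pen_def by blast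
  then have min: "u \<in> minimizers y \<alpha>" "v \<in> minimizers y \<alpha>"
    unfolding mem_minimizers_iff[OF y(1)] by blast+
  \<comment> \<open>The two minimizers lie on opposite sides of the level, so equal model values
    must coincide with it.\<close>
  then have "model y u = model y v"
    using single_valued[OF act *(1) min] y(1) by (simp add: quad_model_eq)
  moreover have "slo * val y \<le> shi * val y" using sigma(2) y(3) by simp
  ultimately have "admissible y \<alpha>"
    using admissible_iff[OF act *(1) min(1)] *(4,5) by auto
  then show ?thesis ..
qed

lemma exists_step:
  assumes "s \<in> S" "active s y"
  shows "\<exists>y'. step y y'"
proof (cases "ereal slo < quad_model Jd G H y xs / Jd y")
  case True
  with exists_admissible[OF assms] obtain \<alpha> where \<alpha>: "admissible y \<alpha>" by blast
  then obtain y' where "y' \<in> minimizers y \<alpha>" by (auto simp only: admissible_param_def)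
  with True \<alpha> show ?thesis unfolding iter_step_def by (simp only: if_True) blast
qed (simp add: iter_step_def)

text \<open>In the branch returning \<open>xs\<close>, the failed test itself bounds the model by
  \<open>slo * val y\<close>, which is below the upper threshold.\<close>

lemma step_model_le:
  assumes act: "s \<in> S" "active s y" and step: "step y y'"
  shows "model y y' \<le> shi * val y"
proof (cases "ereal slo < quad_model Jd G H y xs / Jd y")
  case True
  then obtain \<alpha> where "admissible y \<alpha>" "y' \<in> minimizers y \<alpha>"
    using step by (auto simp: iter_step_def)
  then show ?thesis
    using admissible_iff[OF act] by (auto simp: admissible_param_def)
next
  case False
  then have "y' = xs" "model y xs \<le> slo * val y"
    using step guess_condition_iff[OF act] by (auto simp: iter_step_def)
  moreover have "slo * val y \<le> shi * val y"
    using sigma(2) activeD[OF act] by simp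
  ultimately show ?thesis by simp
qed

text \<open>
  If \<open>al = 0\<close> then Isabelle's quotient is \<open>0\<close>, but no step is possible from an active iterate:
  the existence of a step implies \<open>al > 0\<close>.
\<close>

lemma step_descent:
  assumes "s \<in> S" "active s y" "step y y'"
  shows "0 < al" "0 \<le> (shi - 1 + bl) / al" "val y' \<le> (shi - 1 + bl) / al * val y"
proof -
  note y = activeD[OF assms(1,2)] and y' = step_mem[OF assms(3)]
  have le: "al * val y' \<le> (shi - 1 + bl) * val y"
    using step_model_le[OF assms] model_bounds(1)[OF y(1) y'] by (simp add: algebra_simps)
  moreover have "0 \<le> al * val y'" using val_nonneg[OF y'] consts_nonneg(1) by simp
  ultimately have "0 \<le> (shi - 1 + bl) * val y" by linarith
  \<comment> \<open>Since \<open>val y > 0\<close>, the sign passes to the factor;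
    \<open>param2\<close> bounds this factor strictly by \<open>al\<close>.\<close>
  then have nonneg: "0 \<le> shi - 1 + bl" using y(3) by (simp add: zero_le_mult_iff)
  then show "0 < al" using param2 by linarith
  then show "0 \<le> (shi - 1 + bl) / al" "val y' \<le> (shi - 1 + bl) / al * val y"
    using le nonneg by (auto simp: field_simps)
qed

text \<open>For a regularized minimizer \<open>y'\<close>, the competitor \<open>x\<close> has the
  smaller model value, so minimality leaves it the larger penalty. For \<open>y' = xs\<close> the
  penalty is zero.\<close>

lemma step_penalty_le:
  assumes act: "s \<in> S" "active s y" and step: "step y y'" and x: "x \<in> Mt" "Jd x \<le> ereal e"
  shows "R y' \<le> R x"
proof (cases "ereal slo < quad_model Jd G H y xs / Jd y")
  case True
  then obtain \<alpha> where \<alpha>: "admissible y \<alpha>" "y' \<in> minimizers y \<alpha>"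
    using step by (auto simp: iter_step_def)
  then have pos: "0 < \<alpha>" by (simp add: admissible_param_def)
  have mem: "y \<in> Mt" "y' \<in> Mt" using activeD[OF act] step_mem[OF step] by auto
  have "model y y' + \<alpha> * pen y' \<le> model y x + \<alpha> * pen x"
    using \<alpha>(2) x(1) by (simp add: mem_minimizers_iff[OF mem(1)])
  moreover have "model y x < slo * val y" by (rule model_less_if_near_solution[OF act x])
  moreover have "slo * val y \<le> model y y'" using admissible_iff[OF act pos \<alpha>(2)] \<alpha>(1) by simp
  ultimately have "\<alpha> * pen y' < \<alpha> * pen x" by linarith
  then show ?thesis using pos R_eq[OF mem(2)] R_eq[OF x(1)]
    by (metis ereal_less_eq(3) less_imp_le mult_le_cancel_left_pos)
next
  case False
  then show ?thesis using step R_xs R_nonneg by (auto simp: iter_step_def)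
qed

section \<open>Complete runs at a fixed noise level\<close>

lemma exists_iteration:
  assumes "s \<in> S"
  shows "\<exists>x. iteration Jd G H R Mt xs slo shi (\<tau> * e) s x"
proof -
  \<comment> \<open>The choice is meaningful only where a successor exists. This is known at active
    iterates, and activity at \<open>k\<close> requires all earlier steps to be valid, hence the
    strong induction.\<close>
  define x where "x = rec_nat s (\<lambda>_ y. SOME y'. step y y')"
  have "step (x k) (x (Suc k))" if "enat k < stop x" for k
    using that
  proof (induction k rule: less_induct)
    case (less k)
    have "step (x j) (x (Suc j))" if "j < k" for j
      using less that by (meson enat_ord_simps(2) less_trans)
    then have "active s (x k)"
      unfolding active_iterate_def using less.prems by (intro exI[of _ x] exI[of _ k]) (auto simp: x_def)
    then have "\<exists>y'. step (x k) y'" by (rule exists_step[OF assms])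
    then show ?case by (simp add: x_def someI_ex)
  qed
  moreover have "x 0 = s" by (simp add: x_def)
  ultimately show ?thesis by (auto simp: iteration_def)
qed

context
  fixes s x
  assumes s: "s \<in> S" and iter: "iteration Jd G H R Mt xs slo shi (\<tau> * e) s x"
begin

lemma iteration_step: "enat k < stop x \<Longrightarrow> step (x k) (x (Suc k))"
  using iter by (simp add: iteration_def)

lemma iteration_active:
  assumes "enat k < stop x"
  shows "active s (x k)"
proof -
  have "step (x j) (x (Suc j))" if "j < k" for j
    using that assms by (meson enat_ord_simps(2) iteration_step less_trans)
  then show ?thesis
    using iter assms unfolding active_iterate_def iteration_def by blast
qed

lemma iteration_mem:
  assumes "enat k \<le> stop x"
  shows "x k \<in> Mt"
proof (cases k)
  case 0
  then show ?thesis using iter s starts by (auto simp: iteration_def)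
next
  case (Suc j)
  then show ?thesis using iteration_step[of j] assms step_mem
    by (metis Suc_ile_eq)
qed

lemma iteration_descent:
  assumes "enat (Suc k) \<le> stop x"
  shows "Jd (x (Suc k)) \<le> ereal ((shi - 1 + bl) / al) * Jd (x k)"
proof -
  have k: "enat k < stop x" using assms by (simp add: Suc_ile_eq)
  show ?thesis
    using step_descent(3)[OF s iteration_active[OF k] iteration_step[OF k]]
      iteration_mem[OF assms] iteration_mem[of k] k by (simp add: Jd_eq)
qed

lemma iteration_penalty_le:
  assumes "enat (Suc k) \<le> stop x" "z \<in> Mt" "Jd z \<le> ereal e"
  shows "R (x (Suc k)) \<le> R z"
proof -
  have k: "enat k < stop x" using assms(1) by (simp add: Suc_ile_eq)
  show ?thesis
    by (rule step_penalty_le[OF s iteration_active[OF k] iteration_step[OF k] assms(2,3)])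
qed

text \<open>In a run that never stops every iterate is active, so the values stay above
  \<open>\<tau> * e > 0\<close> although they decay geometrically.\<close>

lemma stop_index_finite: "stop x \<noteq> \<infinity>"
proof
  assume inf: "stop x = \<infinity>"
  define p where "p = (shi - 1 + bl) / al"
  note descent = step_descent[OF s iteration_active iteration_step]
  \<comment> \<open>The step at index 0 exists because the run does not stop, and it already forces
    \<open>al > 0\<close>.\<close>
  have al: "0 < al" and p: "0 \<le> p" using descent[of 0] inf by (auto simp: p_def)
  have "p < 1" using al param2 by (simp add: p_def field_simps)
  have "val (x k) \<le> p ^ k * val (x 0)" for k
  proof (induction k)
    case (Suc k)
    have "val (x (Suc k)) \<le> p * val (x k)" using descent(3)[of k] inf by (simp add: p_def)
    also have "\<dots> \<le> p * (p ^ k * val (x 0))" using Suc p by (rule mult_left_mono)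
    finally show ?case by simp
  qed simp
  moreover have "\<tau> * e < val (x k)" for k
    using activeD(2)[OF s iteration_active] inf by simp
  ultimately have "\<tau> * e \<le> p ^ k * val (x 0)" for k
    by (meson less_imp_le order_trans)
  moreover have "(\<lambda>k. p ^ k * val (x 0)) \<longlonglongrightarrow> 0"
    using LIMSEQ_power_zero[of p] p \<open>p < 1\<close> by (auto intro: tendsto_mult_left_zero)
  ultimately have "\<tau> * e \<le> 0" by (meson LIMSEQ_le_const)
  then show False using tau e_pos by (simp add: mult_le_0_iff)
qed

end

end


section \<open>Limits for vanishing noise\<close>

lemma limit_of_almost_solutions:
  fixes J :: "'a \<Rightarrow> ereal" and Jd :: "real \<Rightarrow> 'a \<Rightarrow> ereal"
  assumes J_nonneg: "\<forall>x\<in>M. 0 \<le> J x"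
    and Jd_finite: "\<forall>\<delta>\<in>{0<..dbar}. \<forall>x\<in>Mt \<delta>. \<bar>Jd \<delta> x\<bar> \<noteq> \<infinity>"
    and eta_lim: "(\<eta> \<longlongrightarrow> 0) (at_right 0)"
    and T_space: "topspace T = UNIV"
    and T_closed: "\<forall>(z :: nat \<Rightarrow> 'a) (\<delta> :: nat \<Rightarrow> real) l.
           (\<forall>n. \<delta> n \<in> {0<..dbar}) \<longrightarrow> \<delta> \<longlonglongrightarrow> 0 \<longrightarrow> (\<forall>n. z n \<in> Mt (\<delta> n)) \<longrightarrow>
           limitin T z l sequentially \<longrightarrow> l \<in> M"
    and J_sup: "\<exists>l\<le>0. ((\<lambda>\<delta>. SUP x\<in>Mt \<delta>. J x - Jd \<delta> x) \<longlongrightarrow> l) (at_right 0)"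
    and J_lsc: "lsc_map T J"
    and ds: "\<And>j. ds j \<in> {0<..dbar}" "ds \<longlonglongrightarrow> 0"
    and z: "\<And>j. z j \<in> Mt (ds j)" "\<And>j. Jd (ds j) (z j) \<le> ereal (C * \<eta> (ds j))"
    and lim: "limitin T z l sequentially"
  shows "is_arg_min J (\<lambda>x. x \<in> M) l"
proof -
  have right: "filterlim ds (at_right 0) sequentially"
    using ds by (intro tendsto_imp_filterlim_at_right) auto
  \<comment> \<open>\<open>J (z j)\<close> is at most the supremum of \<open>J - Jd\<close>, whose
    limit is nonpositive, plus \<open>Jd (ds j) (z j)\<close>, bounded by a null sequence; each part
    receives half of \<open>c\<close>.\<close>
  have small: "\<forall>\<^sub>F j in sequentially. J (z j) < ereal c" if "0 < c" for c
  proof -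
    let ?S = "\<lambda>\<delta>. SUP x\<in>Mt \<delta>. J x - Jd \<delta> x"
    obtain k where k: "k \<le> 0" "(?S \<longlongrightarrow> k) (at_right 0)" using J_sup by blast
    have "k < ereal (c / 2)"
      using k(1) that by (metis ereal_less(2) half_gt_zero le_less_trans)
    then have "\<forall>\<^sub>F j in sequentially. ?S (ds j) < ereal (c / 2)"
      using filterlim_compose[OF k(2) right] by (rule order_tendstoD(2)[rotated])
    moreover have "(\<lambda>j. C * \<eta> (ds j)) \<longlonglongrightarrow> 0"
      using filterlim_compose[OF eta_lim right] by (rule tendsto_mult_right_zero)
    then have "\<forall>\<^sub>F j in sequentially. C * \<eta> (ds j) < c / 2"
      using that by (intro order_tendstoD(2)) auto
    ultimately show ?thesis
    proof eventually_elim
      case (elim j)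
      have "J (z j) - Jd (ds j) (z j) \<le> ?S (ds j)" using z(1) by (rule SUP_upper)
      with elim(1) have less: "J (z j) - Jd (ds j) (z j) < ereal (c / 2)" by (rule order.strict_trans1[rotated])
      \<comment> \<open>Finiteness of this value allows the difference of extended reals to be
        undone.\<close>
      obtain v where v: "Jd (ds j) (z j) = ereal v"
        using Jd_finite[rule_format, OF ds(1) z(1)] by (metis ereal_cases abs_ereal.simps(2,3))
      then have "v < c / 2" using z(2)[of j] elim(2) by simp
      then show ?case using less v by (cases "J (z j)") auto
    qed
  qed
  \<comment> \<open>Were \<open>J l\<close> above \<open>c\<close>, the open superlevel set around
    \<open>l\<close> would eventually contain \<open>z j\<close>.\<close>
  have "J l \<le> ereal c" if "0 < c" for c
  proof (rule ccontr)
    assume "\<not> ?thesis"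
    then have "l \<in> {x \<in> topspace T. ereal c < J x}" using T_space by simp
    moreover have "openin T {x \<in> topspace T. ereal c < J x}"
      using J_lsc by (simp add: lsc_map_def)
    ultimately have "\<forall>\<^sub>F j in sequentially. z j \<in> {x \<in> topspace T. ereal c < J x}"
      using lim unfolding limitin_def by blast
    with small[OF that] have "\<forall>\<^sub>F j :: nat in sequentially. False"
      by eventually_elim auto
    then show False by simp
  qed
  then have "J l \<le> 0"
    using ereal_le_epsilon2[of "J l" 0] by (metis add_0)
  moreover have "l \<in> M" using T_closed ds z(1) lim by blast
  ultimately show ?thesis
    using J_nonneg by (auto simp: is_arg_min_def not_less intro: order_trans)
qed

section \<open>Well-definedness, decay and subsequential convergence of the a posteriori
  method\<close>

theorem theorem3p3:
  fixes M :: "'a::banach set"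
    and J :: "'a \<Rightarrow> ereal"
    and xd xs x0 :: 'a
    and dbar :: real
    and Mt :: "real \<Rightarrow> 'a set"
    and Jd :: "real \<Rightarrow> 'a \<Rightarrow> ereal"
    and \<eta> :: "real \<Rightarrow> real"
    and G :: "real \<Rightarrow> 'a \<Rightarrow> 'a \<Rightarrow> real"
    and H :: "real \<Rightarrow> 'a \<Rightarrow> 'a \<Rightarrow> 'a \<Rightarrow> real"
    and R :: "'a \<Rightarrow> ereal"
    and T0 T T1 :: "'a topology"
    and al bl au bu slo shi \<tau> :: real
    and a b c \<alpha>0 \<theta> :: real
    and starts :: "'a set"
    and active :: "real \<Rightarrow> 'a \<Rightarrow> bool"
    and iter :: "real \<Rightarrow> 'a \<Rightarrow> (nat \<Rightarrow> 'a) \<Rightarrow> bool"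
    and kstar :: "real \<Rightarrow> (nat \<Rightarrow> 'a) \<Rightarrow> enat"
  defines "starts \<equiv> (\<Inter>\<delta>\<in>{0<..<dbar}. Mt \<delta>) \<inter> M"
    and "active \<equiv> (\<lambda>\<delta> y. \<exists>s\<in>starts.
           active_iterate (Jd \<delta>) (G \<delta>) (H \<delta>) R (Mt \<delta>) xs slo shi (\<tau> * \<eta> \<delta>) s y)"
    and "iter \<equiv> (\<lambda>\<delta>. iteration (Jd \<delta>) (G \<delta>) (H \<delta>) R (Mt \<delta>) xs slo shi (\<tau> * \<eta> \<delta>))"
    and "kstar \<equiv> (\<lambda>\<delta>. stop_index (Jd \<delta>) (\<tau> * \<eta> \<delta>))"
  (* exact problem *)
  assumes J_proper: "\<forall>x. J x \<noteq> -\<infinity>" "\<exists>x. J x \<noteq> \<infinity>"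
    and J_nonneg: "\<forall>x\<in>M. 0 \<le> J x"
    and xd_sol: "xd \<in> M" "J xd = 0"
  (* noisy problems *)
    and dbar_pos: "0 < dbar"
    and Jd_finite: "\<forall>\<delta>\<in>{0<..dbar}. \<forall>x\<in>Mt \<delta>. \<bar>Jd \<delta> x\<bar> \<noteq> \<infinity>"
    and Jd_nonneg: "\<forall>\<delta>\<in>{0<..dbar}. \<forall>x\<in>Mt \<delta>. 0 \<le> Jd \<delta> x"
    and xd_noisy: "\<forall>\<delta>\<in>{0<..<dbar}. xd \<in> Mt \<delta> \<and> Jd \<delta> xd \<le> ereal (\<eta> \<delta>)"
    and eta_pos: "\<forall>\<delta>\<in>{0<..<dbar}. 0 < \<eta> \<delta>"
    and eta_lim: "(\<eta> \<longlongrightarrow> 0) (at_right 0)"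
    and G_linear: "\<forall>\<delta>\<in>{0<..dbar}. \<forall>x\<in>Mt \<delta>. linear (G \<delta> x)"
    and H_bilinear: "\<forall>\<delta>\<in>{0<..dbar}. \<forall>x\<in>Mt \<delta>. bilinear (H \<delta> x)"
  (* regularization functional and a priori guess *)
    and R_nonneg: "\<forall>x. 0 \<le> R x"
    and R_proper: "\<exists>x. R x \<noteq> \<infinity>"
    and R_dom: "(\<Union>\<delta>\<in>{0<..<dbar}. Mt \<delta>) \<union> M \<subseteq> {x. R x < \<infinity>}"
    and xs_mem: "xs \<in> (\<Inter>\<delta>\<in>{0<..<dbar}. Mt \<delta>) \<inter> M"
  (* single-valuedness of the model on the minimizers *)
    and single_valued: "\<forall>\<delta>\<in>{0<..<dbar}. \<forall>y. active \<delta> y \<longrightarrow> (\<forall>\<alpha>>0.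
           \<forall>u\<in>reg_minimizers (Jd \<delta>) (G \<delta>) (H \<delta>) R (Mt \<delta>) y \<alpha>.
           \<forall>v\<in>reg_minimizers (Jd \<delta>) (G \<delta>) (H \<delta>) R (Mt \<delta>) y \<alpha>.
             quad_model (Jd \<delta>) (G \<delta>) (H \<delta>) y u = quad_model (Jd \<delta>) (G \<delta>) (H \<delta>) y v)"
  (* existence of minimizers *)
    and T0_space: "topspace T0 = UNIV"
    and T0_compact: "\<forall>\<delta>\<in>{0<..<dbar}. \<forall>r::real. R xd \<le> ereal r \<longrightarrow>
           compactin T0 {x \<in> Mt \<delta>. R x \<le> ereal r}"
    and T0_lsc: "\<forall>\<delta>\<in>{0<..<dbar}. \<forall>y. active \<delta> y \<longrightarrow> (\<forall>\<alpha>>0.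
           lsc_map T0 (\<lambda>x. quad_model (Jd \<delta>) (G \<delta>) (H \<delta>) y x + ereal \<alpha> * R x))"
  (* convergence; the compactness is sequential, positive denominators are part of the bound *)
    and abc: "b < a" "0 \<le> b" "0 \<le> c"
    and apriori: "0 < \<alpha>0" "0 < \<theta>" "\<theta> < 1"
    and denominators: "0 < \<tau> * (a - b) - c" "0 < a * \<theta> - b"
    and abc_ineq: "\<forall>\<delta>\<in>{0<..<dbar}. \<forall>x\<in>Mt \<delta>. \<forall>xp\<in>Mt \<delta>.
           ereal a * Jd \<delta> xp - ereal b * Jd \<delta> x - ereal c * Jd \<delta> xd
           \<le> ereal (G \<delta> x (xp - xd) + 1/2 * H \<delta> x (xp - x) (xp - x)
                    - 1/2 * H \<delta> x (x - xd) (x - xd))"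
    and x0_start: "x0 \<in> starts"
    and T_space: "topspace T = UNIV"
    and T_compact: "seq_compactin T {x \<in> (\<Union>\<delta>\<in>{0<..<dbar}. Mt \<delta>).
           R x \<le> ereal (1 + (a - b) / (\<tau> * (a - b) - c) * ((\<tau> * b + c) / (a * \<theta> - b))) * R xd
                + ereal ((a - b) / (\<tau> * (a - b) - c) * ((\<tau> * b + c) / \<alpha>0)) * J x0}"
    and T_closed: "\<forall>(z :: nat \<Rightarrow> 'a) (\<delta> :: nat \<Rightarrow> real) l.
           (\<forall>n. \<delta> n \<in> {0<..dbar}) \<longrightarrow> \<delta> \<longlonglongrightarrow> 0 \<longrightarrow> (\<forall>n. z n \<in> Mt (\<delta> n)) \<longrightarrow>
           limitin T z l sequentially \<longrightarrow> l \<in> M"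
    and J_sup: "\<exists>l\<le>0. ((\<lambda>\<delta>. SUP x\<in>Mt \<delta>. J x - Jd \<delta> x) \<longlongrightarrow> l) (at_right 0)"
    and J_lsc: "lsc_map T J"
  (* a priori guess and regularization functional *)
    and T1_space: "topspace T1 = UNIV"
    and R_xs: "R xs = 0"
    and R_conv: "\<forall>z :: nat \<Rightarrow> 'a. (\<lambda>j. R (z j)) \<longlonglongrightarrow> 0 \<longrightarrow> limitin T1 z xs sequentially"
    and T1_compact: "\<forall>r::real. compactin T1 {x. R x \<le> ereal r}"
    and T1_lsc: "lsc_map T1 R"
    and T1_cont: "\<forall>\<delta>\<in>{0<..<dbar}. \<forall>y. active \<delta> y \<longrightarrow>
           continuous_map T1 euclideanreal
             (\<lambda>x. G \<delta> y (x - y) + 1/2 * H \<delta> y (x - y) (x - y))"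
    and T1_closed: "\<forall>\<delta>\<in>{0<..<dbar}. closedin T1 (Mt \<delta>)"
  (* two-sided bound and constants *)
    and consts_nonneg: "0 \<le> al" "0 \<le> bl" "0 \<le> au" "0 \<le> bu"
    and two_sided: "\<forall>\<delta>\<in>{0<..<dbar}. \<forall>x\<in>Mt \<delta>. \<forall>xp\<in>Mt \<delta>.
           ereal al * Jd \<delta> xp - ereal bl * Jd \<delta> x
             \<le> ereal (G \<delta> x (xp - x) + 1/2 * H \<delta> x (xp - x) (xp - x)) \<and>
           ereal (G \<delta> x (xp - x) + 1/2 * H \<delta> x (xp - x) (xp - x))
             \<le> ereal au * Jd \<delta> xp - ereal bu * Jd \<delta> x"
    and tau: "1 < \<tau>"
    and sigma: "0 < slo" "slo < shi" "shi < 1"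
    and param1: "1 + au / \<tau> < slo + bu"
    and param2: "shi + bl < 1 + al"
  shows
    "(\<forall>\<delta>\<in>{0<..<dbar}. \<forall>s\<in>starts.
        (\<forall>y. active_iterate (Jd \<delta>) (G \<delta>) (H \<delta>) R (Mt \<delta>) xs slo shi (\<tau> * \<eta> \<delta>) s y \<longrightarrow>
             ereal slo < quad_model (Jd \<delta>) (G \<delta>) (H \<delta>) y xs / Jd \<delta> y \<longrightarrow>
             (\<exists>\<alpha>. admissible_param (Jd \<delta>) (G \<delta>) (H \<delta>) R (Mt \<delta>) slo shi y \<alpha>)) \<and>
        (\<exists>x. iter \<delta> s x) \<and>
        (\<forall>x. iter \<delta> s x \<longrightarrow>
             kstar \<delta> x \<noteq> \<infinity> \<and>
             (\<forall>k\<ge>1. enat k \<le> kstar \<delta> x \<longrightarrow>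
                Jd \<delta> (x k) \<le> ereal ((shi - 1 + bl) / al) * Jd \<delta> (x (k - 1))) \<and>
             (\<forall>xh. (\<forall>\<delta>'\<in>{0<..<dbar}. xh \<in> Mt \<delta>' \<and> Jd \<delta>' xh \<le> ereal (\<eta> \<delta>')) \<longrightarrow>
                (\<forall>k\<ge>1. enat k \<le> kstar \<delta> x \<longrightarrow> R (x k) \<le> R xh) \<and>
                is_arg_min J (\<lambda>z. z \<in> M) xh))) \<and>
     (shi - 1 + bl) / al < 1 \<and>
     (\<forall>X :: real \<Rightarrow> nat \<Rightarrow> 'a. (\<forall>\<delta>\<in>{0<..<dbar}. iter \<delta> x0 (X \<delta>)) \<longrightarrow>
        (\<forall>ds :: nat \<Rightarrow> real. (\<forall>j. ds j \<in> {0<..<dbar}) \<and> ds \<longlonglongrightarrow> 0 \<longrightarrow>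
           (let z = (\<lambda>j. X (ds j) (the_enat (kstar (ds j) (X (ds j))))) in
              (\<exists>r l. strict_mono r \<and> limitin T (z \<circ> r) l sequentially) \<and>
              (\<forall>r l. strict_mono r \<and> limitin T (z \<circ> r) l sequentially \<longrightarrow>
                 is_arg_min J (\<lambda>z. z \<in> M) l))))"
proof -
  have noisy: "noisy_problem (Jd \<delta>) (G \<delta>) (H \<delta>) R (Mt \<delta>) starts xs xd T1 slo shi \<tau> (\<eta> \<delta>) al bl au bu"
    if \<delta>: "\<delta> \<in> {0<..<dbar}" for \<delta>
  proof
    have \<delta>': "\<delta> \<in> {0<..dbar}" using \<delta> by auto
    show "\<bar>Jd \<delta> x\<bar> \<noteq> \<infinity>" if "x \<in> Mt \<delta>" for x using Jd_finite \<delta>' that by simp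
    show "0 \<le> Jd \<delta> x" if "x \<in> Mt \<delta>" for x using Jd_nonneg \<delta>' that by blast
    show "R x < \<infinity>" if "x \<in> Mt \<delta>" for x using R_dom \<delta> that by blast
    show "starts \<subseteq> Mt \<delta>" using \<delta> by (auto simp: starts_def)
    show "continuous_map T1 euclideanreal (\<lambda>x. G \<delta> y (x - y) + 1/2 * H \<delta> y (x - y) (x - y))"
      if "s \<in> starts" "active_iterate (Jd \<delta>) (G \<delta>) (H \<delta>) R (Mt \<delta>) xs slo shi (\<tau> * \<eta> \<delta>) s y" for s y
      using T1_cont \<delta> that unfolding active_def by blast
    show "quad_model (Jd \<delta>) (G \<delta>) (H \<delta>) y u = quad_model (Jd \<delta>) (G \<delta>) (H \<delta>) y v"
      if "s \<in> starts" "active_iterate (Jd \<delta>) (G \<delta>) (H \<delta>) R (Mt \<delta>) xs slo shi (\<tau> * \<eta> \<delta>) s y" "0 < \<alpha>"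
        "u \<in> reg_minimizers (Jd \<delta>) (G \<delta>) (H \<delta>) R (Mt \<delta>) y \<alpha>"
        "v \<in> reg_minimizers (Jd \<delta>) (G \<delta>) (H \<delta>) R (Mt \<delta>) y \<alpha>" for s y \<alpha> u v
      using single_valued \<delta> that unfolding active_def by blast
    show "ereal al * Jd \<delta> xp - ereal bl * Jd \<delta> x
             \<le> ereal (G \<delta> x (xp - x) + 1/2 * H \<delta> x (xp - x) (xp - x)) \<and>
           ereal (G \<delta> x (xp - x) + 1/2 * H \<delta> x (xp - x) (xp - x))
             \<le> ereal au * Jd \<delta> xp - ereal bu * Jd \<delta> x"
      if "x \<in> Mt \<delta>" "xp \<in> Mt \<delta>" for x xp using two_sided \<delta> that by blast
    show "xs \<in> Mt \<delta>" using xs_mem \<delta> by blast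
    show "xd \<in> Mt \<delta>" "Jd \<delta> xd \<le> ereal (\<eta> \<delta>)" "0 < \<eta> \<delta>" using xd_noisy eta_pos \<delta> by auto
    show "closedin T1 (Mt \<delta>)" using T1_closed \<delta> by blast
  qed (use tau R_nonneg R_xs R_conv T1_compact T1_lsc consts_nonneg sigma param1 param2 in auto)

  note almost_solutions =
    limit_of_almost_solutions[OF J_nonneg Jd_finite eta_lim T_space T_closed J_sup J_lsc]

  \<comment> \<open>The limit result is applied to the constant sequence \<open>xh\<close> with
    \<open>C = 1\<close>, along noise levels tending to 0.\<close>
  have solution: "is_arg_min J (\<lambda>z. z \<in> M) xh"
    if xh: "\<forall>\<delta>\<in>{0<..<dbar}. xh \<in> Mt \<delta> \<and> Jd \<delta> xh \<le> ereal (\<eta> \<delta>)" for xh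
  proof (rule almost_solutions)
    \<comment> \<open>The double successor keeps the noise level strictly below \<open>dbar\<close>
      also for \<open>n = 0\<close>.\<close>
    define ds where "ds n = dbar / real (Suc (Suc n))" for n
    have ds: "ds n \<in> {0<..<dbar}" for n
      using dbar_pos by (auto simp: ds_def field_simps intro: add_pos_nonneg)
    then show "ds n \<in> {0<..dbar}" for n by (meson greaterThanAtMost_iff greaterThanLessThan_iff less_imp_le)
    show "ds \<longlonglongrightarrow> 0"
      unfolding ds_def by (intro LIMSEQ_Suc lim_const_over_n)
    show "xh \<in> Mt (ds n)" "Jd (ds n) xh \<le> ereal (1 * \<eta> (ds n))" for n
      using xh ds[of n] by auto
    show "limitin T (\<lambda>n. xh) xh sequentially" by (simp add: T_space)
  qed

  have part1: "(\<forall>y. active_iterate (Jd \<delta>) (G \<delta>) (H \<delta>) R (Mt \<delta>) xs slo shi (\<tau> * \<eta> \<delta>) s y \<longrightarrow>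
             ereal slo < quad_model (Jd \<delta>) (G \<delta>) (H \<delta>) y xs / Jd \<delta> y \<longrightarrow>
             (\<exists>\<alpha>. admissible_param (Jd \<delta>) (G \<delta>) (H \<delta>) R (Mt \<delta>) slo shi y \<alpha>)) \<and>
        (\<exists>x. iter \<delta> s x) \<and>
        (\<forall>x. iter \<delta> s x \<longrightarrow>
             kstar \<delta> x \<noteq> \<infinity> \<and>
             (\<forall>k\<ge>1. enat k \<le> kstar \<delta> x \<longrightarrow>
                Jd \<delta> (x k) \<le> ereal ((shi - 1 + bl) / al) * Jd \<delta> (x (k - 1))) \<and>
             (\<forall>xh. (\<forall>\<delta>'\<in>{0<..<dbar}. xh \<in> Mt \<delta>' \<and> Jd \<delta>' xh \<le> ereal (\<eta> \<delta>')) \<longrightarrow>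
                (\<forall>k\<ge>1. enat k \<le> kstar \<delta> x \<longrightarrow> R (x k) \<le> R xh) \<and>
                is_arg_min J (\<lambda>z. z \<in> M) xh))"
    if \<delta>: "\<delta> \<in> {0<..<dbar}" and s: "s \<in> starts" for \<delta> s
  proof -
    interpret noisy_problem "Jd \<delta>" "G \<delta>" "H \<delta>" R "Mt \<delta>" starts xs xd T1 slo shi \<tau> "\<eta> \<delta>" al bl au bu
      by (rule noisy[OF \<delta>])
    have descent: "Jd \<delta> (x k) \<le> ereal ((shi - 1 + bl) / al) * Jd \<delta> (x (k - 1))"
      if "iter \<delta> s x" "1 \<le> k" "enat k \<le> kstar \<delta> x" for x k
      using that iteration_descent[OF s, of x "k - 1"] unfolding iter_def kstar_def by simp
    have penalty: "R (x k) \<le> R xh"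
      if "iter \<delta> s x" "1 \<le> k" "enat k \<le> kstar \<delta> x"
        "\<forall>\<delta>'\<in>{0<..<dbar}. xh \<in> Mt \<delta>' \<and> Jd \<delta>' xh \<le> ereal (\<eta> \<delta>')" for x k xh
      using that \<delta> iteration_penalty_le[OF s, of x "k - 1" xh] unfolding iter_def kstar_def by simp
    show ?thesis
    proof (intro conjI allI impI)
      show "\<exists>\<alpha>. admissible y \<alpha>"
        if "active_iterate (Jd \<delta>) (G \<delta>) (H \<delta>) R (Mt \<delta>) xs slo shi (\<tau> * \<eta> \<delta>) s y"
          "ereal slo < quad_model (Jd \<delta>) (G \<delta>) (H \<delta>) y xs / Jd \<delta> y" for y
        by (rule exists_admissible[OF s that])
      show "\<exists>x. iter \<delta> s x"
        unfolding iter_def by (rule exists_iteration[OF s])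
      show "kstar \<delta> x \<noteq> \<infinity>" if "iter \<delta> s x" for x
        using stop_index_finite[OF s] that unfolding iter_def kstar_def .
    qed (rule descent penalty solution; assumption)+
  qed

  \<comment> \<open>For \<open>al = 0\<close> the quotient is 0 by convention.\<close>
  have factor: "(shi - 1 + bl) / al < 1"
    using consts_nonneg(1) param2 by (cases "al = 0") (auto simp: field_simps)

  have part2: "(\<exists>r l. strict_mono r \<and> limitin T (z \<circ> r) l sequentially) \<and>
      (\<forall>r l. strict_mono r \<and> limitin T (z \<circ> r) l sequentially \<longrightarrow> is_arg_min J (\<lambda>z. z \<in> M) l)"
    if X: "\<forall>\<delta>\<in>{0<..<dbar}. iter \<delta> x0 (X \<delta>)"
      and ds: "\<And>j. ds j \<in> {0<..<dbar}" "ds \<longlonglongrightarrow> 0"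
      and z_def: "z = (\<lambda>j. X (ds j) (the_enat (kstar (ds j) (X (ds j)))))"
    for X ds z
  proof -
    have kstar_finite: "kstar (ds j) (X (ds j)) \<noteq> \<infinity>" for j
      using part1[OF ds(1) x0_start] X ds(1) by meson
    define n where "n j = the_enat (kstar (ds j) (X (ds j)))" for j
    have z_eq: "z j = X (ds j) (n j)" for j by (simp add: z_def n_def)
    have iter: "iter (ds j) x0 (X (ds j))" for j using X ds(1) by blast
    have n: "kstar (ds j) (X (ds j)) = enat (n j)" for j
      using kstar_finite[of j] unfolding n_def by (cases "kstar (ds j) (X (ds j))") auto
    have z_mem: "z j \<in> Mt (ds j)" for j
      using noisy_problem.iteration_mem[OF noisy[OF ds(1)] x0_start iter[unfolded iter_def]]
        n[of j] unfolding z_eq kstar_def by simp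
    have z_small: "Jd (ds j) (z j) \<le> ereal (\<tau> * \<eta> (ds j))" for j
      using noisy_problem.stop_index_eq_enatD[OF noisy[OF ds(1)] n[of j, unfolded kstar_def]]
      unfolding z_eq .
    \<comment> \<open>The penalty bound with \<open>xd\<close> as near-solution starts at index 1;
      the penalty of \<open>x0\<close> is not controlled by it.\<close>
    have R_le: "R (z j) \<le> R xd" if "n j \<noteq> 0" for j
    proof -
      from that have "1 \<le> n j" by simp
      moreover have "enat (n j) \<le> kstar (ds j) (X (ds j))" using n[of j] by simp
      ultimately show ?thesis
        using part1[OF ds(1) x0_start, of j] iter[of j] xd_noisy unfolding z_eq by meson
    qed
    define p where "p = 1 + (a - b) / (\<tau> * (a - b) - c) * ((\<tau> * b + c) / (a * \<theta> - b))"
    define q where "q = (a - b) / (\<tau> * (a - b) - c) * ((\<tau> * b + c) / \<alpha>0)"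
    define B where "B = {x \<in> (\<Union>\<delta>\<in>{0<..<dbar}. Mt \<delta>). R x \<le> ereal p * R xd + ereal q * J x0}"
    \<comment> \<open>With \<open>J x0 \<ge> 0\<close>, the radius in the compactness assumption is
      thus at least \<open>R xd\<close>.\<close>
    have "1 \<le> p" "0 \<le> q"
      using abc apriori denominators tau by (auto simp: p_def q_def)
    moreover have "0 \<le> J x0" using x0_start J_nonneg by (simp add: starts_def)
    ultimately have "ereal 1 * R xd + 0 \<le> ereal p * R xd + ereal q * J x0"
      using R_nonneg by (intro add_mono ereal_mult_right_mono) auto
    then have bound: "R xd \<le> ereal p * R xd + ereal q * J x0"
      by (simp add: one_ereal_def[symmetric])
    have z_B: "z j \<in> B" if "n j \<noteq> 0" for j
    proof -
      have "R (z j) \<le> ereal p * R xd + ereal q * J x0"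
        using R_le[OF that] bound by (rule order_trans)
      then show ?thesis using z_mem[of j] ds(1)[of j] unfolding B_def by blast
    qed
    have "\<exists>r l. strict_mono r \<and> limitin T (z \<circ> r) l sequentially"
    proof (cases "infinite {j. n j = 0}")
      case True
      \<comment> \<open>Runs that stop at once return \<open>x0\<close>, which need not lie in the compact set.\<close>
      then obtain r :: "nat \<Rightarrow> nat" where r: "strict_mono r" "\<And>j. n (r j) = 0"
        using infinite_enumerate[of "{j. n j = 0}"] by blast
      have "X (ds j) 0 = x0" for j
        using iter[of j] unfolding iter_def iteration_def by blast
      then have "z \<circ> r = (\<lambda>_. x0)" using r(2) by (auto simp: z_eq)
      then have "limitin T (z \<circ> r) x0 sequentially" by (simp add: T_space)
      then show ?thesis using r(1) by blast
    next
      case False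
      \<comment> \<open>Runs making at least one step end in \<open>B\<close>, so sequential
        compactness yields a second extraction, which is composed with the first.\<close>
      then have "infinite {j. n j \<noteq> 0}"
        by (simp only: Collect_neg_eq finite_compl) simp
      then obtain r :: "nat \<Rightarrow> nat" where r: "strict_mono r" "\<And>j. n (r j) \<noteq> 0"
        using infinite_enumerate[of "{j. n j \<noteq> 0}"] by blast
      have "range (z \<circ> r) \<subseteq> B" using z_B r(2) by auto
      then obtain l r' where "strict_mono r'" "limitin T ((z \<circ> r) \<circ> r') l sequentially"
        using T_compact[folded p_def q_def, folded B_def] unfolding seq_compactin_def by blast
      then have "strict_mono (r \<circ> r')" "limitin T (z \<circ> (r \<circ> r')) l sequentially"
        using strict_mono_o[OF r(1)] by (simp_all add: comp_assoc)
      then show ?thesis by blast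
    qed
    \<comment> \<open>The stopping rule supplies the limit result with \<open>C = \<tau>\<close>
      along the subsequence; this covers runs that stop at once as well.\<close>
    moreover have "is_arg_min J (\<lambda>z. z \<in> M) l"
      if r: "strict_mono r" and lim: "limitin T (z \<circ> r) l sequentially" for r l
    proof (rule almost_solutions)
      show "(ds \<circ> r) j \<in> {0<..dbar}" for j using ds(1)[of "r j"] by auto
      show "(ds \<circ> r) \<longlonglongrightarrow> 0" using LIMSEQ_subseq_LIMSEQ[OF ds(2) r] .
      show "(z \<circ> r) j \<in> Mt ((ds \<circ> r) j)"
        "Jd ((ds \<circ> r) j) ((z \<circ> r) j) \<le> ereal (\<tau> * \<eta> ((ds \<circ> r) j))" for j
        using z_mem z_small by auto
      show "limitin T (z \<circ> r) l sequentially" by (rule lim)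
    qed
    ultimately show ?thesis by blast
  qed
  show ?thesis
    unfolding Let_def
    by (intro conjI[OF _ conjI[OF factor]] ballI part1)
       (assumption | intro allI impI, elim conjE, rule part2, (assumption | rule refl | erule spec)+)+
qed

end
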